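(* Let $h\ge 1$ and let $\Gamma=(X,\mathcal{B},\mu,A,E)$ be an $h$-layered commutative measure graph with layering $X=X_0 \sqcup \cdots \sqcup X_h$. Then for every $j \in \{1, \ldots, h\}$ we have $$D_j^h \geq D_h^j.$$
   Context: A labelled directed graph is a tuple $(V,E,A)$ with $V,A$ sets and $E\subset V\times V\times A$; $(v,w,a)\in E$ is an edge from $v$ (its tail) to $w$ (its head) labelled $a$. For $W\subset V$ and $a\in A$, $Im_a^+(W)=\{v\in V : (w,v,a)\in E \text{ for some } w\in W\}$, $Im_a^-(W)=\{v\in V : (v,w,a)\in E\text{ for some }w\in W\}$, and $Im^{\pm}(W)=\bigcup_{a\in A}Im_a^{\pm}(W)$. Put $Im^0(W)=W$ and $Im^h(W)=Im^+(Im^{h-1}(W))$ for $h>0$. $E^+(v)$ denotes the set of edges with tail $v$. A measure graph is a tuple $(V,\mathcal{B},\mu,A,E)$ where $(V,\mathcal{B},\mu)$ is a finite measure space, $A$ is a finite set and $(V,E,A)$ is a labelled directed graph such that: (1) for each $a\in A$ the sets $L_a^+=\{x\in V : \exists y\in V,\ (x,y,a)\in E\}$ and $L_a^-=\{x\in V : \exists y\in V,\ (y,x,a)\in E\}$ are measurable; (2) for $a\in A$ and measurable $W\subset L_a^{\pm}$, $Im_a^{\pm}(W)$ is measurable and $\mu(W)=\mu(Im_a^{\pm}(W))$; (3) $|Im_a^{\pm}(\{x\})|\le 1$ for all $a\in A$, $x\in V$. An $h$-layered graph is a labelled directed graph with a partition $V=V_0\sqcup\cdots\sqcup V_h$ such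 that each edge $(x,y,a)$ has $x\in V_i$, $y\in V_{i+1}$ for some $i\in\{0,\dots,h-1\}$; for measure graphs the layers are assumed measurable. A layered graph is semi-commutative if for every edge $(x,y,a)\in E$ there is an injection $\phi:E^+(y)\to E^+(x)$ with $(head(\phi(e)),head(e),a)\in E$ for all $e\in E^+(y)$. It is commutative if both it and its dual (obtained by reversing all edges and the order of the layers) are semi-commutative. For $j\in\{1,\dots,h\}$ the magnification ratio of order $j$ of an $h$-layered commutative measure graph with bottom layer $V_0$ is $$D_j=\inf\left\{\frac{\mu(Im^j(Y))}{\mu(Y)} : Y\subset V_0\text{ measurable},\ \mu(Y)>0\right\},$$ with the usual convention $\inf\emptyset=+\infty$. *)

theory Defs
  imports "HOL-Analysis.Analysis"
begin

section \<open>Labelled directed graphs\<close>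

text \<open>An edge from \<open>v\<close> to \<open>w\<close> labelled \<open>a\<close> is the triple \<open>(v, w, a)\<close>.\<close>

type_synonym ('v, 'a) edge = "'v \<times> 'v \<times> 'a"

locale labelled_digraph =
  fixes V :: "'v set" and A :: "'a set" and E :: "('v, 'a) edge set"
  assumes edges_subset: "E \<subseteq> V \<times> V \<times> A"

definition edge_tail :: "('v, 'a) edge \<Rightarrow> 'v" where
  "edge_tail e = fst e"

definition edge_head :: "('v, 'a) edge \<Rightarrow> 'v" where
  "edge_head e = fst (snd e)"

definition out_edges :: "('v, 'a) edge set \<Rightarrow> 'v \<Rightarrow> ('v, 'a) edge set" where
  "out_edges E v = {e \<in> E. edge_tail e = v}"

text \<open>In a labelled digraph both endpoints of an edge lie in \<open>V\<close>, so the images below are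
  automatically subsets of \<open>V\<close>.\<close>

definition img_plus :: "('v, 'a) edge set \<Rightarrow> 'a \<Rightarrow> 'v set \<Rightarrow> 'v set" where
  "img_plus E a W = {v. \<exists>w\<in>W. (w, v, a) \<in> E}"

definition img_minus :: "('v, 'a) edge set \<Rightarrow> 'a \<Rightarrow> 'v set \<Rightarrow> 'v set" where
  "img_minus E a W = {v. \<exists>w\<in>W. (v, w, a) \<in> E}"

definition Img_plus :: "'a set \<Rightarrow> ('v, 'a) edge set \<Rightarrow> 'v set \<Rightarrow> 'v set" where
  "Img_plus A E W = (\<Union>a\<in>A. img_plus E a W)"

definition Img_iter :: "'a set \<Rightarrow> ('v, 'a) edge set \<Rightarrow> nat \<Rightarrow> 'v set \<Rightarrow> 'v set" where
  "Img_iter A E k W = (Img_plus A E ^^ k) W"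

definition L_plus :: "('v, 'a) edge set \<Rightarrow> 'a \<Rightarrow> 'v set" where
  "L_plus E a = {x. \<exists>y. (x, y, a) \<in> E}"

definition L_minus :: "('v, 'a) edge set \<Rightarrow> 'a \<Rightarrow> 'v set" where
  "L_minus E a = {x. \<exists>y. (y, x, a) \<in> E}"

section \<open>Measure graphs\<close>

text \<open>The vertex set is \<^term>\<open>space M\<close>. Finiteness is stated next to the cardinality bounds
  because \<^const>\<open>card\<close> is \<open>0\<close> on infinite sets.\<close>

locale measure_graph = finite_measure M + labelled_digraph "space M" A E
  for M :: "'v measure" and A :: "'a set" and E :: "('v, 'a) edge set" +
  assumes finite_labels: "finite A"
    and L_plus_measurable: "\<And>a. a \<in> A \<Longrightarrow> L_plus E a \<in> sets M"
    and L_minus_measurable: "\<And>a. a \<in> A \<Longrightarrow> L_minus E a \<in> sets M"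
    and img_plus_measurable:
      "\<And>a W. a \<in> A \<Longrightarrow> W \<in> sets M \<Longrightarrow> W \<subseteq> L_plus E a \<Longrightarrow> img_plus E a W \<in> sets M"
    and img_plus_measure:
      "\<And>a W. a \<in> A \<Longrightarrow> W \<in> sets M \<Longrightarrow> W \<subseteq> L_plus E a \<Longrightarrow>
        emeasure M W = emeasure M (img_plus E a W)"
    and img_minus_measurable:
      "\<And>a W. a \<in> A \<Longrightarrow> W \<in> sets M \<Longrightarrow> W \<subseteq> L_minus E a \<Longrightarrow> img_minus E a W \<in> sets M"
    and img_minus_measure:
      "\<And>a W. a \<in> A \<Longrightarrow> W \<in> sets M \<Longrightarrow> W \<subseteq> L_minus E a \<Longrightarrow>
        emeasure M W = emeasure M (img_minus E a W)"
    and img_plus_card: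
      "\<And>a x. a \<in> A \<Longrightarrow> x \<in> space M \<Longrightarrow> finite (img_plus E a {x}) \<and> card (img_plus E a {x}) \<le> 1"
    and img_minus_card:
      "\<And>a x. a \<in> A \<Longrightarrow> x \<in> space M \<Longrightarrow> finite (img_minus E a {x}) \<and> card (img_minus E a {x}) \<le> 1"

section \<open>Layered and commutative graphs\<close>

text \<open>Only the values \<open>X 0, \<dots>, X h\<close> of the layering are relevant, and layers may be empty.\<close>

locale layered_graph = labelled_digraph V A E
  for V :: "'v set" and A :: "'a set" and E :: "('v, 'a) edge set" +
  fixes h :: nat and X :: "nat \<Rightarrow> 'v set"
  assumes layers_disjoint: "disjoint_family_on X {0..h}"
    and layers_cover: "V = (\<Union>i\<in>{0..h}. X i)"
    and layers_edges: "\<And>x y a. (x, y, a) \<in> E \<Longrightarrow> \<exists>i\<in>{0..<h}. x \<in> X i \<and> y \<in> X (Suc i)"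

locale layered_measure_graph = measure_graph M A E + layered_graph "space M" A E h X
  for M :: "'v measure" and A :: "'a set" and E :: "('v, 'a) edge set"
    and h :: nat and X :: "nat \<Rightarrow> 'v set" +
  assumes layers_measurable: "\<And>i. i \<in> {0..h} \<Longrightarrow> X i \<in> sets M"

definition semi_commutative :: "('v, 'a) edge set \<Rightarrow> bool" where
  "semi_commutative E \<longleftrightarrow>
    (\<forall>x y a. (x, y, a) \<in> E \<longrightarrow>
      (\<exists>\<phi>. \<phi> \<in> out_edges E y \<rightarrow> out_edges E x \<and> inj_on \<phi> (out_edges E y) \<and>
        (\<forall>e\<in>out_edges E y. (edge_head (\<phi> e), edge_head e, a) \<in> E)))"

text \<open>The layers of the dual graph are \<open>X h, \<dots>, X 0\<close>; semi-commutativity does not mention the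
  layers, so only the edges of the dual are needed.\<close>

definition dual_edges :: "('v, 'a) edge set \<Rightarrow> ('v, 'a) edge set" where
  "dual_edges E = {(y, x, a) |x y a. (x, y, a) \<in> E}"

definition commutative_graph :: "('v, 'a) edge set \<Rightarrow> bool" where
  "commutative_graph E \<longleftrightarrow> semi_commutative E \<and> semi_commutative (dual_edges E)"

section \<open>Magnification ratios\<close>

text \<open>In \<^typ>\<open>ennreal\<close> the infimum of the empty set is \<open>\<infinity>\<close>, which is its value if the bottom
  layer \<open>V0\<close> is a null set.\<close>

definition magnification_ratio ::
  "'v measure \<Rightarrow> 'a set \<Rightarrow> ('v, 'a) edge set \<Rightarrow> 'v set \<Rightarrow> nat \<Rightarrow> ennreal" where
  "magnification_ratio M A E V0 j =
    (INF Y\<in>{Y \<in> sets M. Y \<subseteq> V0 \<and> emeasure M Y > 0}.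
      emeasure M (Img_iter A E j Y) / emeasure M Y)"

end

theory Submission
  imports Defs
begin

text \<open>
  Write \<open>D\<^sub>h = C ^ h\<close> and give the vertices of layer \<open>k\<close> the weight \<open>C ^ -k\<close>. The inequality
  \<open>D\<^sub>j \<ge> C ^ j\<close> is a statement about cuts, that is, sets of vertices which every path from the
  bottom layer to the top layer has to meet. For \<open>Z \<subseteq> X 0\<close> the set \<open>(X 0 - Z) \<union> Im\<^sup>j Z\<close> is a
  cut, and it has weight at least \<open>\<mu> (X 0)\<close> exactly if \<open>\<mu> (Im\<^sup>j Z) \<ge> C ^ j * \<mu> Z\<close>. So it suffices
  that every cut has weight at least \<open>\<mu> (X 0)\<close> (\<open>weight_cut_ge\<close>).

  For a cut \<open>S \<subseteq> X 0 \<union> X h\<close> this is the definition of \<open>D\<^sub>h\<close>: everything reached at height \<open>h\<close>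
  from \<open>X 0 - S\<close> lies in \<open>S \<inter> X h\<close> (\<open>weight_end_cut_ge\<close>). The heart of the matter is that
  commutativity allows one to move the inner layers of a cut of least weight upwards until only
  the two ends are left. Let \<open>S\<close> be the part of such a cut in an inner layer, \<open>P\<close> the vertices below
  it on the bottom side of the cut and \<open>Q\<close> those above it on the top side. A part \<open>T\<close> of \<open>S\<close>
  can be replaced by its successors in \<open>Q\<close> or by its predecessors in \<open>P\<close>; as the weight does not
  drop, \<open>T\<close> has at least \<open>C * \<mu> T\<close> successors and at least \<open>\<mu> T / C\<close> predecessors. By
  commutativity, in-degrees do not decrease along edges from \<open>S\<close> to \<open>Q\<close>. Adding up the first
  estimate over the level sets \<open>T\<close> of the in-degree on \<open>S\<close> gives \<open>e(S, Q) \<ge> C * e(P, S)\<close> for the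
  numbers of edges. The dual argument gives the opposite inequality, so each of the estimates that
  were added is an equality, and \<open>S\<close> may be replaced by its successors in \<open>Q\<close> at no cost.

  In a measure space a cut of least weight need not exist. Therefore all of this is done with an
  additive error: a cut whose weight is within \<open>\<epsilon>\<close> of the infimum can be cleared from an inner
  layer so that the weight stays within a constant multiple of \<open>\<epsilon>\<close> (\<open>clear_layer\<close>), where the
  constant depends only on \<open>C\<close> and on the number of labels, which bounds all degrees.
\<close>

section \<open>Duality and images\<close>

lemma mem_dual_edges [simp]: "(y, x, a) \<in> dual_edges E \<longleftrightarrow> (x, y, a) \<in> E"
  by (auto simp: dual_edges_def)

lemma dual_edges_dual_edges [simp]: "dual_edges (dual_edges E) = E"
  by auto

lemma img_plus_dual_edges: "img_plus (dual_edges E) a W = img_minus E a W"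
  by (auto simp: img_plus_def img_minus_def)

lemma img_minus_dual_edges: "img_minus (dual_edges E) a W = img_plus E a W"
  by (auto simp: img_plus_def img_minus_def)

lemma L_plus_dual_edges: "L_plus (dual_edges E) a = L_minus E a"
  by (auto simp: L_plus_def L_minus_def)

lemma L_minus_dual_edges: "L_minus (dual_edges E) a = L_plus E a"
  by (auto simp: L_plus_def L_minus_def)

lemma (in measure_graph) measure_graph_dual_edges: "measure_graph M A (dual_edges E)"
proof (unfold_locales, goal_cases)
  case 1
  show ?case using edges_subset by (auto simp: dual_edges_def)
qed (simp_all add: img_plus_dual_edges img_minus_dual_edges L_plus_dual_edges L_minus_dual_edges
       finite_labels L_plus_measurable L_minus_measurable img_plus_measurable img_minus_measurable
       img_plus_card[unfolded One_nat_def] img_minus_card[unfolded One_nat_def]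
       flip: img_plus_measure img_minus_measure)

lemma (in labelled_digraph) mem_Img_plus: "y \<in> Img_plus A E W \<longleftrightarrow> (\<exists>x\<in>W. \<exists>a. (x, y, a) \<in> E)"
  using edges_subset by (auto simp: Img_plus_def img_plus_def)

lemma (in labelled_digraph) mem_Img_plus_dual_edges:
  "x \<in> Img_plus A (dual_edges E) W \<longleftrightarrow> (\<exists>y\<in>W. \<exists>a. (x, y, a) \<in> E)"
  using edges_subset by (auto simp: Img_plus_def img_plus_def)

context measure_graph
begin

lemma head_unique:
  assumes "(x, y, a) \<in> E" "(x, y', a) \<in> E"
  shows "y = y'"
proof -
  have "a \<in> A" "x \<in> space M" using assms edges_subset by auto
  from img_plus_card[OF this] have "finite (img_plus E a {x})" "card (img_plus E a {x}) \<le> Suc 0"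
    by auto
  moreover have "y \<in> img_plus E a {x}" "y' \<in> img_plus E a {x}"
    using assms by (auto simp: img_plus_def)
  ultimately show ?thesis by (simp add: card_le_Suc0_iff_eq)
qed

lemma tail_unique:
  assumes "(x, y, a) \<in> E" "(x', y, a) \<in> E"
  shows "x = x'"
  using measure_graph.head_unique[OF measure_graph_dual_edges, of y x a x'] assms by simp

lemma img_plus_sets:
  assumes "a \<in> A" "W \<in> sets M"
  shows "img_plus E a W \<in> sets M"
proof -
  have "img_plus E a W = img_plus E a (W \<inter> L_plus E a)"
    by (auto simp: img_plus_def L_plus_def)
  then show ?thesis
    using img_plus_measurable[of a "W \<inter> L_plus E a"] L_plus_measurable assms by auto
qed

lemma Img_plus_sets [intro]: "W \<in> sets M \<Longrightarrow> Img_plus A E W \<in> sets M"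
  unfolding Img_plus_def using img_plus_sets finite_labels by auto

lemma Img_plus_dual_edges_sets [intro]:
  "W \<in> sets M \<Longrightarrow> Img_plus A (dual_edges E) W \<in> sets M"
  using measure_graph.Img_plus_sets[OF measure_graph_dual_edges] .

text \<open>Both sides measure the set of edges labelled \<open>a\<close> from \<open>P\<close> to \<open>S\<close>, once at the heads and once
  at the tails. They agree because the label \<open>a\<close> acts as a measure preserving partial injection.\<close>
lemma measure_edges_eq:
  assumes a: "a \<in> A" and P: "P \<in> sets M" and S: "S \<in> sets M"
  shows "measure M (S \<inter> img_plus E a P) = measure M (P \<inter> img_plus (dual_edges E) a S)"
proof -
  let ?W = "P \<inter> img_plus (dual_edges E) a S"
  have "?W \<subseteq> L_plus E a" by (auto simp: img_plus_def L_plus_def)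
  moreover have "?W \<in> sets M"
    using measure_graph.img_plus_sets[OF measure_graph_dual_edges a S] P by auto
  ultimately have "emeasure M ?W = emeasure M (img_plus E a ?W)"
    by (intro img_plus_measure[OF a])
  also have "img_plus E a ?W = S \<inter> img_plus E a P"
    by (auto simp: img_plus_def dest: head_unique)
  finally show ?thesis by (simp add: measure_def)
qed

end

section \<open>Double counting in three consecutive layers\<close>

text \<open>The layer cake formula for the integral over \<open>S\<close> of the number of sets \<open>F a\<close> that contain a
  given point.\<close>
lemma (in finite_measure) sum_measure_levels:
  assumes A: "finite A" and S: "S \<in> sets M" and F: "\<And>a. a \<in> A \<Longrightarrow> F a \<in> sets M"
  shows "\<And>t. {x \<in> S. t \<le> card {a \<in> A. x \<in> F a}} \<in> sets M"
    and "(\<Sum>t = 1..card A. measure M {x \<in> S. t \<le> card {a \<in> A. x \<in> F a}}) =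
      (\<Sum>a\<in>A. measure M (S \<inter> F a))"
proof -
  let ?d = "\<lambda>x. card {a \<in> A. x \<in> F a}"
  have d: "real (?d x) = (\<Sum>a\<in>A. indicator (F a) x)" for x
    using A by (simp add: indicator_def sum.If_cases Int_def conj_commute)
  have "{x \<in> S. t \<le> ?d x} = S \<inter> {x \<in> space M. real t \<le> (\<Sum>a\<in>A. indicator (F a) x)}" for t
    using sets.sets_into_space[OF S] by (auto simp flip: d)
  moreover have "{x \<in> space M. real t \<le> (\<Sum>a\<in>A. indicator (F a) x)} \<in> sets M" for t
    using F by measurable
  ultimately show L: "{x \<in> S. t \<le> ?d x} \<in> sets M" for t
    using S by auto
  have pointwise: "(\<Sum>t = 1..card A. indicator {x \<in> S. t \<le> ?d x} x) =
      (\<Sum>a\<in>A. indicator (S \<inter> F a) x :: real)" for x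
  proof (cases "x \<in> S")
    case True
    have "?d x \<le> card A" using A by (intro card_mono) auto
    then have "{1..card A} \<inter> {t. t \<le> ?d x} = {1..?d x}" by auto
    then have "(\<Sum>t = 1..card A. indicator {x \<in> S. t \<le> ?d x} x) = real (?d x)"
      using True by (simp add: indicator_def sum.If_cases)
    then show ?thesis using True d[of x] by (simp add: indicator_def)
  qed (simp add: indicator_def)
  have "(\<Sum>t = 1..card A. measure M {x \<in> S. t \<le> ?d x}) =
      (\<integral>x. (\<Sum>t = 1..card A. indicator {x \<in> S. t \<le> ?d x} x) \<partial>M)"
    using L by (subst Bochner_Integration.integral_sum) (auto intro: integrable_real_indicator simp: less_top[symmetric])
  also have "\<dots> = (\<integral>x. (\<Sum>a\<in>A. indicator (S \<inter> F a) x) \<partial>M)"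
    by (simp only: pointwise)
  also have "\<dots> = (\<Sum>a\<in>A. measure M (S \<inter> F a))"
    using S F by (subst Bochner_Integration.integral_sum) (auto intro: integrable_real_indicator simp: less_top[symmetric])
  finally show "(\<Sum>t = 1..card A. measure M {x \<in> S. t \<le> ?d x}) = (\<Sum>a\<in>A. measure M (S \<inter> F a))" .
qed

text \<open>This is the integral over \<open>S\<close> of the number of edges from \<open>P\<close>, counted with labels: since a
  label has at most one edge into each vertex, it contributes the indicator of its image of \<open>P\<close>.\<close>
definition edge_mass ::
  "'v measure \<Rightarrow> 'a set \<Rightarrow> ('v, 'a) edge set \<Rightarrow> 'v set \<Rightarrow> 'v set \<Rightarrow> real" where
  "edge_mass M A E P S = (\<Sum>a\<in>A. measure M (S \<inter> img_plus E a P))"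

context measure_graph
begin

lemma edge_mass_dual_edges:
  assumes "P \<in> sets M" "S \<in> sets M"
  shows "edge_mass M A (dual_edges E) S P = edge_mass M A E P S"
  unfolding edge_mass_def using measure_edges_eq[OF _ assms] by simp

text \<open>Dual semi-commutativity along \<open>(y, z, a)\<close> sends each edge into \<open>y\<close> to an edge into \<open>z\<close>. If the
  former starts at \<open>x \<in> P\<close>, the latter starts at a vertex \<open>w\<close> with an edge from \<open>x\<close>; so
  \<open>x\<close>, \<open>w\<close>, \<open>z\<close> is a path from \<open>P\<close> to \<open>Q\<close>, which has to pass through \<open>S\<close>.\<close>
lemma in_degree_mono:
  assumes comm: "semi_commutative (dual_edges E)"
    and mid: "\<And>x w z a b. x \<in> P \<Longrightarrow> z \<in> Q \<Longrightarrow> (x, w, a) \<in> E \<Longrightarrow> (w, z, b) \<in> E \<Longrightarrow> w \<in> S"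
    and z: "z \<in> Q" and yz: "(y, z, a) \<in> E"
  shows "card {b \<in> A. y \<in> img_plus E b P} \<le> card {b \<in> A. z \<in> img_plus E b S}"
proof -
  obtain \<phi> where
    \<phi>: "\<phi> \<in> out_edges (dual_edges E) y \<rightarrow> out_edges (dual_edges E) z"
      "inj_on \<phi> (out_edges (dual_edges E) y)"
      "\<And>e. e \<in> out_edges (dual_edges E) y \<Longrightarrow>
        (edge_head (\<phi> e), edge_head e, a) \<in> dual_edges E"
    using comm yz unfolding semi_commutative_def by (metis mem_dual_edges)
  (* A label determines the edge into a given vertex, so it is enough to map labels to labels. *)
  have "\<exists>x\<in>P. (x, y, b) \<in> E" if "y \<in> img_plus E b P" for b
    using that by (auto simp: img_plus_def)
  then obtain p where p: "\<And>b. y \<in> img_plus E b P \<Longrightarrow> p b \<in> P \<and> (p b, y, b) \<in> E"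
    by metis
  define f where "f b = snd (snd (\<phi> (y, p b, b)))" for b
  have f: "\<exists>w\<in>S. \<phi> (y, p b, b) = (z, w, f b) \<and> (w, z, f b) \<in> E"
    if b: "y \<in> img_plus E b P" for b
  proof -
    have e: "(y, p b, b) \<in> out_edges (dual_edges E) y"
      using p[OF b] by (simp add: out_edges_def edge_tail_def)
    obtain z' w c where eq: "\<phi> (y, p b, b) = (z', w, c)" by (cases "\<phi> (y, p b, b)")
    have "\<phi> (y, p b, b) \<in> out_edges (dual_edges E) z" using \<phi>(1) e by auto
    then have z': "z' = z" "(w, z, c) \<in> E" by (auto simp: eq out_edges_def edge_tail_def)
    have "(p b, w, a) \<in> E" using \<phi>(3)[OF e] by (simp add: eq edge_head_def)
    then have "w \<in> S" using mid[of "p b" z] p[OF b] z z' by blast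
    then show ?thesis using eq z' by (auto simp: f_def)
  qed
  have "inj_on f {b \<in> A. y \<in> img_plus E b P}"
  proof (rule inj_onI, clarify)
    fix b b' assume b: "y \<in> img_plus E b P" and b': "y \<in> img_plus E b' P" and eq: "f b = f b'"
    have "\<phi> (y, p b, b) = \<phi> (y, p b', b')"
      using f[OF b] f[OF b'] eq by (auto dest: tail_unique)
    moreover have "(y, p b, b) \<in> out_edges (dual_edges E) y"
      "(y, p b', b') \<in> out_edges (dual_edges E) y"
      using p[OF b] p[OF b'] by (simp_all add: out_edges_def edge_tail_def)
    ultimately show "b = b'" using \<phi>(2) by (auto dest: inj_onD)
  qed
  moreover have "f ` {b \<in> A. y \<in> img_plus E b P} \<subseteq> {b \<in> A. z \<in> img_plus E b S}"
  proof clarify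
    fix b assume "b \<in> A" "y \<in> img_plus E b P"
    from f[OF this(2)] obtain w where w: "w \<in> S" "(w, z, f b) \<in> E" by auto
    then show "f b \<in> A \<and> z \<in> img_plus E (f b) S" using edges_subset by (auto simp: img_plus_def)
  qed
  ultimately show ?thesis using finite_labels by (intro card_inj_on_le) auto
qed

text \<open>Apply the expansion hypothesis to each level set of the in-degree from \<open>P\<close> on \<open>S\<close>; by
  \<open>in_degree_mono\<close> its successors in \<open>Q\<close> lie in the corresponding level set on \<open>Q\<close>. Summation over the
  levels gives \<open>C * edge_mass P S \<le> edge_mass S Q\<close> up to the error. The set \<open>T\<close> is the lowest level
  set, and its actual expansion is kept in the sum instead of the lower bound: when the two edge
  masses are known to be nearly in ratio \<open>C\<close>, this bounds the expansion of \<open>T\<close> from above.\<close>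
lemma edge_mass_expand:
  fixes C \<delta> :: real
  assumes comm: "semi_commutative (dual_edges E)"
    and mid: "\<And>x w z a b. x \<in> P \<Longrightarrow> z \<in> Q \<Longrightarrow> (x, w, a) \<in> E \<Longrightarrow> (w, z, b) \<in> E \<Longrightarrow> w \<in> S"
    and P: "P \<in> sets M" and S: "S \<in> sets M" and Q: "Q \<in> sets M"
    and C: "C \<ge> 0" and \<delta>: "\<delta> \<ge> 0"
    and expand: "\<And>T. T \<in> sets M \<Longrightarrow> T \<subseteq> S \<Longrightarrow>
      C * measure M T - \<delta> \<le> measure M (Img_plus A E T \<inter> Q)"
  defines "T \<equiv> S \<inter> Img_plus A E P"
  shows "C * edge_mass M A E P S + (measure M (Img_plus A E T \<inter> Q) - C * measure M T)
    \<le> edge_mass M A E S Q + card A * \<delta>"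
proof (cases "A = {}")
  case True
  then show ?thesis by (simp add: edge_mass_def T_def Img_plus_def)
next
  case False
  let ?n = "card A"
  have n: "?n \<ge> 1" using False finite_labels by (simp add: Suc_le_eq card_gt_0_iff)
  define L where "L t = {y \<in> S. t \<le> card {b \<in> A. y \<in> img_plus E b P}}" for t
  define L' where "L' t = {z \<in> Q. t \<le> card {b \<in> A. z \<in> img_plus E b S}}" for t
  note levels = sum_measure_levels[OF finite_labels S, of "\<lambda>b. img_plus E b P"]
    sum_measure_levels[OF finite_labels Q, of "\<lambda>b. img_plus E b S"]
  have Ls: "L t \<in> sets M" "L' t \<in> sets M" for t
    using levels(1,3) P S img_plus_sets by (auto simp: L_def L'_def)
  have eL: "edge_mass M A E P S = (\<Sum>t = 1..?n. measure M (L t))"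
    "edge_mass M A E S Q = (\<Sum>t = 1..?n. measure M (L' t))"
    using levels(2,4) P S img_plus_sets by (auto simp: L_def L'_def edge_mass_def)
  have img: "measure M (Img_plus A E (L t) \<inter> Q) \<le> measure M (L' t)" for t
  proof (rule finite_measure_mono)
    show "Img_plus A E (L t) \<inter> Q \<subseteq> L' t"
    proof
      fix z assume z: "z \<in> Img_plus A E (L t) \<inter> Q"
      then obtain y a where y: "y \<in> L t" "(y, z, a) \<in> E" by (auto simp: mem_Img_plus)
      have "card {b \<in> A. y \<in> img_plus E b P} \<le> card {b \<in> A. z \<in> img_plus E b S}"
        using z y(2) by (intro in_degree_mono[where Q = Q] comm) (auto intro: mid)
      then show "z \<in> L' t" using z y(1) by (simp add: L_def L'_def)
    qed
  qed (rule Ls)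
  have T: "T = L 1"
    using finite_labels by (auto simp: T_def L_def Img_plus_def Suc_le_eq card_gt_0_iff)
  have "(\<Sum>t = 1..?n. C * measure M (L t)) - ?n * \<delta> + (measure M (Img_plus A E T \<inter> Q) - C * measure M T)
      = (\<Sum>t = 1..?n. C * measure M (L t) - \<delta>
          + (if t = 1 then measure M (Img_plus A E (L 1) \<inter> Q) - C * measure M (L 1) else 0))"
    using n by (simp add: sum.distrib sum_subtractf T)
  also have "\<dots> \<le> (\<Sum>t = 1..?n. measure M (L' t))"
  proof (rule sum_mono)
    fix t assume "t \<in> {1..?n}"
    show "C * measure M (L t) - \<delta>
        + (if t = 1 then measure M (Img_plus A E (L 1) \<inter> Q) - C * measure M (L 1) else 0)
      \<le> measure M (L' t)"
      using img[of t] expand[of "L t"] Ls[of t] \<delta> by (auto simp: L_def)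
  qed
  finally show ?thesis by (simp add: eL sum_distrib_left)
qed

text \<open>\<open>edge_mass_expand\<close> in the graph and in its dual bound the two edge masses against each other
  from both sides, which leaves no room for the lowest level set to expand by much more than the
  factor \<open>C\<close>.\<close>
lemma near_tight_expansion:
  fixes C \<delta> \<delta>' :: real
  assumes comm: "commutative_graph E"
    and mid: "\<And>x w z a b. x \<in> P \<Longrightarrow> z \<in> Q \<Longrightarrow> (x, w, a) \<in> E \<Longrightarrow> (w, z, b) \<in> E \<Longrightarrow> w \<in> S"
    and P: "P \<in> sets M" and S: "S \<in> sets M" and Q: "Q \<in> sets M"
    and C: "C > 0" and \<delta>: "\<delta> \<ge> 0" and \<delta>': "\<delta>' \<ge> 0"
    and up: "\<And>T. T \<in> sets M \<Longrightarrow> T \<subseteq> S \<Longrightarrow>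
      C * measure M T - \<delta> \<le> measure M (Img_plus A E T \<inter> Q)"
    and down: "\<And>T. T \<in> sets M \<Longrightarrow> T \<subseteq> S \<Longrightarrow>
      measure M T / C - \<delta>' \<le> measure M (Img_plus A (dual_edges E) T \<inter> P)"
  defines "T \<equiv> S \<inter> Img_plus A E P"
  shows "measure M (Img_plus A E T \<inter> Q) \<le> C * measure M T + (card A + 1) * (\<delta> + C * \<delta>')"
proof -
  interpret dual: measure_graph M A "dual_edges E" by (rule measure_graph_dual_edges)
  let ?T' = "S \<inter> Img_plus A (dual_edges E) Q"
  have 1: "C * edge_mass M A E P S + (measure M (Img_plus A E T \<inter> Q) - C * measure M T)
    \<le> edge_mass M A E S Q + card A * \<delta>"
    unfolding T_def using comm
    by (intro edge_mass_expand mid P S Q \<delta> up) (use C in \<open>auto simp: commutative_graph_def\<close>)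
  have "1 / C * edge_mass M A (dual_edges E) Q S
      + (measure M (Img_plus A (dual_edges E) ?T' \<inter> P) - 1 / C * measure M ?T')
    \<le> edge_mass M A (dual_edges E) S P + card A * \<delta>'"
    using comm C down
    by (intro dual.edge_mass_expand P S Q \<delta>')
      (auto simp: commutative_graph_def intro: mid)
  moreover have "measure M ?T' / C - \<delta>' \<le> measure M (Img_plus A (dual_edges E) ?T' \<inter> P)"
    using S Q by (intro down) auto
  ultimately have "edge_mass M A E S Q / C \<le> edge_mass M A E P S + (card A + 1) * \<delta>'"
    by (simp add: edge_mass_dual_edges P S Q algebra_simps)
  then have "edge_mass M A E S Q \<le> C * edge_mass M A E P S + (card A + 1) * (C * \<delta>')"
    using C by (simp add: field_simps)
  with 1 show ?thesis using \<delta> by (simp add: algebra_simps)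
qed

end

section \<open>Cuts of a layered graph\<close>

context layered_measure_graph
begin

lemma edge_layer:
  assumes "(x, y, a) \<in> E"
  obtains i where "i < h" "x \<in> X i" "y \<in> X (Suc i)"
  using layers_edges[OF assms] by auto

lemma layer_unique: "x \<in> X i \<Longrightarrow> x \<in> X k \<Longrightarrow> i \<le> h \<Longrightarrow> k \<le> h \<Longrightarrow> i = k"
  using layers_disjoint by (fastforce simp: disjoint_family_on_def)

lemma layer_sets: "i \<le> h \<Longrightarrow> X i \<in> sets M"
  using layers_measurable by auto

lemma edge_head_layer: "(x, y, a) \<in> E \<Longrightarrow> x \<in> X i \<Longrightarrow> i \<le> h \<Longrightarrow> i < h \<and> y \<in> X (Suc i)"
  by (erule edge_layer) (metis layer_unique less_imp_le)

lemma edge_tail_layer: "(x, y, a) \<in> E \<Longrightarrow> y \<in> X (Suc i) \<Longrightarrow> i < h \<Longrightarrow> x \<in> X i"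
  by (erule edge_layer) (metis layer_unique Suc_leI nat.inject)

definition weight :: "real \<Rightarrow> 'v set \<Rightarrow> real" where
  "weight C D = (\<Sum>k\<le>h. measure M (D \<inter> X k) / C ^ k)"

lemma weight_Un:
  assumes "D \<in> sets M" "D' \<in> sets M" "D \<inter> D' = {}"
  shows "weight C (D \<union> D') = weight C D + weight C D'"
proof -
  have "measure M ((D \<union> D') \<inter> X k) = measure M (D \<inter> X k) + measure M (D' \<inter> X k)" if "k \<le> h" for k
    unfolding Int_Un_distrib2 using assms layer_sets[OF that]
    by (intro finite_measure_Union) auto
  then show ?thesis by (simp add: weight_def add_divide_distrib sum.distrib)
qed

lemma weight_layer:
  assumes "D \<subseteq> X i" "i \<le> h"
  shows "weight C D = measure M D / C ^ i"
proof -
  have "D \<inter> X k = (if k = i then D else {})" if "k \<le> h" for k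
    using assms layer_unique[of _ i k] that by (cases "k = i") auto
  then have "weight C D = (\<Sum>k\<le>h. if k = i then measure M D / C ^ i else 0)"
    unfolding weight_def by (intro sum.cong) auto
  then show ?thesis using assms by simp
qed

lemma weight_nonneg: "C > 0 \<Longrightarrow> weight C D \<ge> 0"
  unfolding weight_def by (intro sum_nonneg) auto

text \<open>A cut is represented by the vertices \<open>R\<close> on the bottom side of it and the union \<open>B\<close> of \<open>R\<close> and
  the separating set \<open>B - R\<close>. In terms of these two sets, separation is a condition on single edges
  and not on paths: an edge that starts in \<open>R\<close> cannot leave \<open>B\<close>.\<close>
definition is_cut :: "'v set \<Rightarrow> 'v set \<Rightarrow> bool" where
  "is_cut R B \<longleftrightarrow> R \<in> sets M \<and> B \<in> sets M \<and> R \<subseteq> B \<and> X 0 \<subseteq> B \<and> Img_plus A E R \<subseteq> B \<and> R \<inter> X h = {}"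

lemma is_cut_edge: "is_cut R B \<Longrightarrow> x \<in> R \<Longrightarrow> (x, y, a) \<in> E \<Longrightarrow> y \<in> B"
  using mem_Img_plus[of y R] unfolding is_cut_def by blast

lemma Img_plus_layer: "T \<subseteq> X i \<Longrightarrow> i < h \<Longrightarrow> Img_plus A E T \<subseteq> X (Suc i)"
  unfolding subset_iff mem_Img_plus using edge_head_layer less_imp_le by blast

lemma Img_plus_dual_layer: "T \<subseteq> X (Suc i) \<Longrightarrow> i < h \<Longrightarrow> Img_plus A (dual_edges E) T \<subseteq> X i"
  unfolding subset_iff mem_Img_plus_dual_edges using edge_tail_layer by blast

text \<open>The part \<open>T\<close> of the separating set joins the bottom side, and its successors that were on the
  top side take its place.\<close>
lemma push_up:
  assumes cut: "is_cut R B" and T: "T \<in> sets M" "T \<subseteq> (B - R) \<inter> X i" and i: "i < h"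
  defines "R' \<equiv> R \<union> T" and "B' \<equiv> B \<union> Img_plus A E T"
  shows "is_cut R' B'"
    and "weight C (B' - R') =
      weight C (B - R) - measure M T / C ^ i + measure M (Img_plus A E T - B) / C ^ Suc i"
proof -
  have s: "R \<in> sets M" "B \<in> sets M" "Img_plus A E T \<in> sets M" "R \<subseteq> B"
    using cut T by (auto simp: is_cut_def)
  have "T \<inter> X h = {}" using T(2) i layer_unique[of _ i h] by auto
  then show "is_cut R' B'"
    using cut T s is_cut_edge[OF cut]
    unfolding is_cut_def[of R'] R'_def B'_def by (auto simp: is_cut_def mem_Img_plus)
  have eq: "(B' - R') \<union> T = (B - R) \<union> (Img_plus A E T - B)"
    using T s by (auto simp: R'_def B'_def)
  have "weight C (B' - R') + weight C T = weight C (B - R) + weight C (Img_plus A E T - B)"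
  proof -
    have "weight C ((B' - R') \<union> T) = weight C (B' - R') + weight C T"
      using s T by (intro weight_Un) (auto simp: R'_def B'_def)
    moreover have "weight C ((B - R) \<union> (Img_plus A E T - B)) = weight C (B - R) + weight C (Img_plus A E T - B)"
      using s T by (intro weight_Un) auto
    ultimately show ?thesis by (simp add: eq)
  qed
  moreover have "weight C T = measure M T / C ^ i"
    using T i by (intro weight_layer) auto
  moreover have "weight C (Img_plus A E T - B) = measure M (Img_plus A E T - B) / C ^ Suc i"
    using Img_plus_layer[of T i] T i by (intro weight_layer) auto
  ultimately show "weight C (B' - R') =
      weight C (B - R) - measure M T / C ^ i + measure M (Img_plus A E T - B) / C ^ Suc i"
    by linarith
qed

text \<open>The part \<open>T\<close> of the separating set joins the top side, and its predecessors that were on the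
  bottom side take its place.\<close>
lemma pull_down:
  assumes cut: "is_cut R B" and T: "T \<in> sets M" "T \<subseteq> (B - R) \<inter> X (Suc i)" and i: "i < h"
  defines "R' \<equiv> R - Img_plus A (dual_edges E) T" and "B' \<equiv> B - T"
  shows "is_cut R' B'"
    and "weight C (B' - R') = weight C (B - R) - measure M T / C ^ Suc i
      + measure M (Img_plus A (dual_edges E) T \<inter> R) / C ^ i"
proof -
  let ?P = "Img_plus A (dual_edges E) T"
  have s: "R \<in> sets M" "B \<in> sets M" "?P \<in> sets M" "R \<subseteq> B"
    using cut T by (auto simp: is_cut_def)
  have P: "?P \<subseteq> X i" using T i by (intro Img_plus_dual_layer) auto
  have TP: "T \<inter> ?P = {}" using P T(2) i layer_unique[of _ i "Suc i"] by fastforce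
  have "T \<inter> X 0 = {}" using T(2) i layer_unique[of _ "Suc i" 0] by auto
  then show "is_cut R' B'"
    using cut T s is_cut_edge[OF cut]
    unfolding is_cut_def[of R'] R'_def B'_def
    by (auto simp: is_cut_def mem_Img_plus mem_Img_plus_dual_edges)
  have eq: "(B' - R') \<union> T = (B - R) \<union> (?P \<inter> R)"
    using T s TP by (auto simp: R'_def B'_def)
  have "weight C (B' - R') + weight C T = weight C (B - R) + weight C (?P \<inter> R)"
  proof -
    have "weight C ((B' - R') \<union> T) = weight C (B' - R') + weight C T"
      using s T by (intro weight_Un) (auto simp: R'_def B'_def)
    moreover have "weight C ((B - R) \<union> (?P \<inter> R)) = weight C (B - R) + weight C (?P \<inter> R)"
      using s T by (intro weight_Un) auto
    ultimately show ?thesis by (simp add: eq)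
  qed
  moreover have "weight C T = measure M T / C ^ Suc i"
    using T i by (intro weight_layer) auto
  moreover have "weight C (?P \<inter> R) = measure M (?P \<inter> R) / C ^ i"
    using P i by (intro weight_layer) auto
  ultimately show "weight C (B' - R') = weight C (B - R) - measure M T / C ^ Suc i
      + measure M (?P \<inter> R) / C ^ i"
    by linarith
qed

text \<open>Near-optimality, tested against the cuts obtained by pushing up and pulling down parts of \<open>S\<close>,
  gives both expansion hypotheses of \<open>near_tight_expansion\<close>. Vertices of \<open>S\<close> without a predecessor
  on the bottom side are useless for the cut and are discarded; the rest \<open>T\<close> is pushed up.\<close>
lemma clear_layer:
  assumes comm: "commutative_graph E" and C: "C > 0" and \<epsilon>: "\<epsilon> \<ge> 0" and i: "Suc i < h"
    and opt: "\<And>R B. is_cut R B \<Longrightarrow> m \<le> weight C (B - R)"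
    and cut: "is_cut R B" and near: "weight C (B - R) \<le> m + \<epsilon>"
  obtains R' B' where "is_cut R' B'" "B' - R' \<subseteq> ((B - R) - X (Suc i)) \<union> X (Suc (Suc i))"
    "weight C (B' - R') \<le> m + (1 + (card A + 1) * (1 + 1 / C)) * \<epsilon>"
proof -
  define P where "P = R \<inter> X i"
  define S where "S = (B - R) \<inter> X (Suc i)"
  define Q where "Q = X (Suc (Suc i)) - B"
  define T where "T = S \<inter> Img_plus A E P"
  have RB: "R \<in> sets M" "B \<in> sets M" "R \<subseteq> B" "Img_plus A E R \<subseteq> B" using cut by (auto simp: is_cut_def)
  have X: "X i \<in> sets M" "X (Suc i) \<in> sets M" "X (Suc (Suc i)) \<in> sets M" using i layer_sets by auto
  have sets: "P \<in> sets M" "S \<in> sets M" "Q \<in> sets M" "T \<in> sets M"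
    using RB X by (auto simp: P_def S_def Q_def T_def)
  have Q_eq: "Img_plus A E W \<inter> Q = Img_plus A E W - B" if "W \<subseteq> S" for W
    using Img_plus_layer[of W "Suc i"] that i by (auto simp: Q_def S_def)
  have P_eq: "Img_plus A (dual_edges E) W \<inter> P = Img_plus A (dual_edges E) W \<inter> R" if "W \<subseteq> S" for W
    using Img_plus_dual_layer[of W i] that i by (auto simp: P_def S_def)
  have "measure M (Img_plus A E T \<inter> Q)
      \<le> C * measure M T + (card A + 1) * (C ^ Suc (Suc i) * \<epsilon> + C * (C ^ i * \<epsilon>))"
    unfolding T_def
  proof (rule near_tight_expansion[OF comm _ sets(1-3) C])
    (* A path from R to the complement of B cannot avoid B - R. *)
    fix x w z a b assume "x \<in> P" "z \<in> Q" and e: "(x, w, a) \<in> E" "(w, z, b) \<in> E"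
    then have "w \<in> B" "w \<notin> R" "w \<in> X (Suc i)"
      using RB i edge_head_layer[OF e(1), of i] by (auto simp: P_def Q_def mem_Img_plus subset_iff)
    then show "w \<in> S" by (simp add: S_def)
  next
    fix W assume W: "W \<in> sets M" "W \<subseteq> S"
    have "is_cut (R \<union> W) (B \<union> Img_plus A E W)"
      using push_up[OF cut W(1) _ i] W S_def by auto
    from opt[OF this] have "m \<le> weight C (B - R) - measure M W / C ^ Suc i
        + measure M (Img_plus A E W - B) / C ^ Suc (Suc i)"
      using push_up(2)[OF cut W(1) _ i, of C] W S_def by auto
    with near have "measure M W / C ^ Suc i - \<epsilon> \<le> measure M (Img_plus A E W - B) / C ^ Suc (Suc i)"
      by linarith
    from mult_left_mono[OF this, of "C ^ Suc (Suc i)"]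
    show "C * measure M W - C ^ Suc (Suc i) * \<epsilon> \<le> measure M (Img_plus A E W \<inter> Q)"
      unfolding Q_eq[OF W(2)] using C by (simp add: right_diff_distrib)
  next
    fix W assume W: "W \<in> sets M" "W \<subseteq> S"
    have i': "i < h" using i by simp
    have "is_cut (R - Img_plus A (dual_edges E) W) (B - W)"
      using pull_down[OF cut W(1) _ i'] W S_def by auto
    from opt[OF this] have "m \<le> weight C (B - R) - measure M W / C ^ Suc i
        + measure M (Img_plus A (dual_edges E) W \<inter> R) / C ^ i"
      using pull_down(2)[OF cut W(1) _ i', of C] W S_def by auto
    with near have "measure M W / C ^ Suc i - \<epsilon> \<le> measure M (Img_plus A (dual_edges E) W \<inter> R) / C ^ i"
      by linarith
    from mult_left_mono[OF this, of "C ^ i"]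
    show "measure M W / C - C ^ i * \<epsilon> \<le> measure M (Img_plus A (dual_edges E) W \<inter> P)"
      unfolding P_eq[OF W(2)] using C by (simp add: right_diff_distrib)
  qed (use C \<epsilon> in auto)
  then have gain: "measure M (Img_plus A E T - B) / C ^ Suc (Suc i)
      \<le> measure M T / C ^ Suc i + (card A + 1) * (1 + 1 / C) * \<epsilon>"
    using C Q_eq[of T] by (simp add: T_def field_simps)
  have ST: "S - T \<in> sets M" "S - T \<subseteq> (B - R) \<inter> X (Suc i)" "i < h"
    using sets i by (auto simp: S_def)
  (* Pulling down a part of S without predecessors in R just deletes it from the cut. *)
  have noP: "Img_plus A (dual_edges E) (S - T) \<inter> R = {}"
    using edge_tail_layer i by (fastforce simp: T_def S_def P_def mem_Img_plus mem_Img_plus_dual_edges)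
  then have R0: "R - Img_plus A (dual_edges E) (S - T) = R" by auto
  note down = pull_down[OF cut ST, unfolded R0 noP]
  have T: "T \<subseteq> (B - (S - T) - R) \<inter> X (Suc i)" by (auto simp: T_def S_def)
  note up = push_up[OF down(1) sets(4) T i]
  let ?R' = "R \<union> T" and ?B' = "B - (S - T) \<union> Img_plus A E T"
  have img: "Img_plus A E T \<subseteq> X (Suc (Suc i))"
    using Img_plus_layer[of T "Suc i"] i by (auto simp: T_def S_def)
  have T_gain: "Img_plus A E T - (B - (S - T)) = Img_plus A E T - B"
    using img layer_unique[of _ "Suc i" "Suc (Suc i)"] i by (auto simp: S_def)
  have "0 \<le> measure M (S - T) / C ^ Suc i" using C by simp
  then have "weight C (?B' - ?R') \<le> m + \<epsilon> + (card A + 1) * (1 + 1 / C) * \<epsilon>"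
    using up(2)[of C, unfolded T_gain] down(2)[of C, unfolded measure_empty] near gain by linarith
  then have "weight C (?B' - ?R') \<le> m + (1 + (card A + 1) * (1 + 1 / C)) * \<epsilon>"
    by (simp only: distrib_right mult_1 add.assoc)
  moreover have "?B' - ?R' \<subseteq> ((B - R) - X (Suc i)) \<union> X (Suc (Suc i))"
    using img by (auto simp: S_def)
  ultimately show thesis using that up(1) by blast
qed

text \<open>Clearing layer \<open>Suc i\<close> adds vertices to layer \<open>Suc (Suc i)\<close> only, so layers that are already
  empty stay empty. To end within \<open>\<epsilon>\<close>, start within \<open>\<epsilon> / K\<close>, where one step
  enlarges the error by the factor \<open>K\<close>.\<close>
lemma near_optimal_cut_at_ends:
  assumes comm: "commutative_graph E" and C: "C > 0"
    and opt: "\<And>R B. is_cut R B \<Longrightarrow> m \<le> weight C (B - R)"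
    and approx: "\<And>\<epsilon>. \<epsilon> > 0 \<Longrightarrow> \<exists>R B. is_cut R B \<and> weight C (B - R) \<le> m + \<epsilon>"
    and "\<epsilon> > 0" "i < h"
  shows "\<exists>R B. is_cut R B \<and> weight C (B - R) \<le> m + \<epsilon> \<and> (\<forall>k\<in>{1..i}. (B - R) \<inter> X k = {})"
  using \<open>i < h\<close> \<open>\<epsilon> > 0\<close>
proof (induction i arbitrary: \<epsilon>)
  case 0
  then show ?case using approx by auto
next
  case (Suc i)
  define K where "K = 1 + (card A + 1) * (1 + 1 / C)"
  have K: "K > 0" using C by (auto simp: K_def intro!: add_pos_nonneg)
  then obtain R B where RB: "is_cut R B" "weight C (B - R) \<le> m + \<epsilon> / K"
      "\<And>k. k \<in> {1..i} \<Longrightarrow> (B - R) \<inter> X k = {}"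
    using Suc.IH[of "\<epsilon> / K"] Suc.prems by auto
  obtain R' B' where R': "is_cut R' B'"
      "B' - R' \<subseteq> ((B - R) - X (Suc i)) \<union> X (Suc (Suc i))"
      "weight C (B' - R') \<le> m + K * (\<epsilon> / K)"
    using clear_layer[OF comm C _ Suc.prems(1) opt RB(1,2)] K Suc.prems(2) unfolding K_def by auto
  have "(B' - R') \<inter> X k = {}" if k: "k \<in> {1..Suc i}" for k
    using R'(2) RB(3)[of k] k Suc.prems(1) layer_unique[of _ k "Suc (Suc i)"]
    by (cases "k = Suc i") fastforce+
  then show ?case using R' K by (intro exI[of _ R'] exI[of _ B']) auto
qed

lemma Img_iter_Suc: "Img_iter A E (Suc k) W = Img_plus A E (Img_iter A E k W)"
  by (simp add: Img_iter_def)

lemma Img_iter_layer: "Z \<subseteq> X 0 \<Longrightarrow> k \<le> h \<Longrightarrow> Img_iter A E k Z \<subseteq> X k"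
proof (induction k)
  case 0
  then show ?case by (simp add: Img_iter_def)
next
  case (Suc k)
  then show ?case unfolding Img_iter_Suc by (intro Img_plus_layer) auto
qed

lemma Img_iter_sets: "Z \<in> sets M \<Longrightarrow> Img_iter A E k Z \<in> sets M"
  by (induction k) (auto simp: Img_iter_Suc, simp_all add: Img_iter_def)

text \<open>A path that starts in \<open>R \<inter> X 0\<close> cannot leave \<open>R\<close> before height \<open>h\<close>, and there it has to end in
  \<open>B \<inter> X h\<close>. So the top part of the cut contains \<open>Im\<^sup>h\<close> of the bottom vertices that the cut misses,
  and by the expansion hypothesis it weighs at least as much as they do.\<close>
lemma weight_end_cut_ge:
  assumes C: "C > 0" and h: "h \<ge> 1"
    and expand: "\<And>Z. Z \<in> sets M \<Longrightarrow> Z \<subseteq> X 0 \<Longrightarrow> C ^ h * measure M Z \<le> measure M (Img_iter A E h Z)"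
    and cut: "is_cut R B" and ends: "\<And>k. k \<in> {1..<h} \<Longrightarrow> (B - R) \<inter> X k = {}"
  shows "measure M (X 0) \<le> weight C (B - R)"
proof -
  let ?Z = "R \<inter> X 0"
  have RB: "R \<in> sets M" "B \<in> sets M" "R \<subseteq> B" "X 0 \<subseteq> B" "Img_plus A E R \<subseteq> B" "R \<inter> X h = {}"
    using cut by (auto simp: is_cut_def)
  have X: "X 0 \<in> sets M" "X h \<in> sets M" using layer_sets by auto
  have inR: "Img_iter A E k ?Z \<subseteq> R" if "k < h" for k
    using that
  proof (induction k)
    case (Suc k)
    then have "Img_iter A E (Suc k) ?Z \<subseteq> B"
      using is_cut_edge[OF cut] by (fastforce simp: Img_iter_Suc mem_Img_plus)
    moreover have "Img_iter A E (Suc k) ?Z \<subseteq> X (Suc k)"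
      using Suc.prems by (intro Img_iter_layer) auto
    ultimately show ?case using ends[of "Suc k"] Suc.prems by auto
  qed (simp add: Img_iter_def)
  obtain h' where h': "h = Suc h'" using h by (cases h) auto
  have "Img_iter A E h ?Z \<subseteq> B"
    using inR[of h'] is_cut_edge[OF cut] by (fastforce simp: h' Img_iter_Suc mem_Img_plus)
  moreover have "Img_iter A E h ?Z \<subseteq> X h" by (intro Img_iter_layer) auto
  ultimately have "measure M (Img_iter A E h ?Z) \<le> measure M (B \<inter> X h)"
    using RB X by (intro finite_measure_mono) auto
  with expand[of ?Z] RB X have "measure M ?Z \<le> measure M (B \<inter> X h) / C ^ h"
    using C by (simp add: field_simps)
  moreover have "measure M (X 0) = measure M (X 0 - R) + measure M ?Z"
  proof -
    have "(X 0 - R) \<union> ?Z = X 0" "(X 0 - R) \<inter> ?Z = {}" by auto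
    then show ?thesis using finite_measure_Union[of "X 0 - R" ?Z] RB X by simp
  qed
  moreover have "weight C (B - R) \<ge> (\<Sum>k\<in>{0, h}. measure M ((B - R) \<inter> X k) / C ^ k)"
    unfolding weight_def using C by (intro sum_mono2) auto
  moreover have "(B - R) \<inter> X 0 = X 0 - R" "(B - R) \<inter> X h = B \<inter> X h" using RB by auto
  ultimately show ?thesis using h by simp
qed

lemma weight_cut_ge:
  assumes comm: "commutative_graph E" and C: "C > 0" and h: "h \<ge> 1"
    and expand: "\<And>Z. Z \<in> sets M \<Longrightarrow> Z \<subseteq> X 0 \<Longrightarrow> C ^ h * measure M Z \<le> measure M (Img_iter A E h Z)"
    and cut: "is_cut R B"
  shows "measure M (X 0) \<le> weight C (B - R)"
proof -
  define W where "W = {weight C (B - R) |R B. is_cut R B}"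
  have W: "W \<noteq> {}" "bdd_below W"
    using cut weight_nonneg[OF C] by (auto simp: W_def intro!: bdd_belowI[of _ 0])
  have opt: "Inf W \<le> weight C (B - R)" if "is_cut R B" for R B
    using W that by (intro cInf_lower) (auto simp: W_def)
  have approx: "\<exists>R B. is_cut R B \<and> weight C (B - R) \<le> Inf W + \<epsilon>" if "\<epsilon> > 0" for \<epsilon>
  proof -
    obtain w where "w \<in> W" "w < Inf W + \<epsilon>"
      using cInf_lessD[OF W(1), of "Inf W + \<epsilon>"] \<open>\<epsilon> > 0\<close> by auto
    then obtain R B where "is_cut R B" "weight C (B - R) < Inf W + \<epsilon>"
      by (auto simp: W_def)
    then show ?thesis by (intro exI[of _ R] exI[of _ B]) auto
  qed
  have "measure M (X 0) \<le> Inf W + \<epsilon>" if "\<epsilon> > 0" for \<epsilon>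
  proof -
    have "h - 1 < h" and eq: "{1..h - 1} = {1..<h}" using h by auto
    from near_optimal_cut_at_ends[OF comm C opt approx that this(1)]
    obtain R B where "is_cut R B" "weight C (B - R) \<le> Inf W + \<epsilon>"
      "\<And>k. k \<in> {1..<h} \<Longrightarrow> (B - R) \<inter> X k = {}" unfolding eq by auto
    moreover from this have "measure M (X 0) \<le> weight C (B - R)"
      using weight_end_cut_ge[OF C h expand, of R B] by auto
    ultimately show ?thesis by simp
  qed
  then have "measure M (X 0) \<le> Inf W" by (rule field_le_epsilon)
  also have "\<dots> \<le> weight C (B - R)" by (rule opt[OF cut])
  finally show ?thesis .
qed

text \<open>The cut with separating set \<open>(X 0 - Z) \<union> Im\<^sup>j Z\<close> is used; its bottom side consists of the images
  of \<open>Z\<close> of height less than \<open>j\<close>.\<close>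
lemma measure_Img_iter_ge:
  assumes comm: "commutative_graph E" and C: "C > 0" and h: "h \<ge> 1" and j: "j \<in> {1..h}"
    and expand: "\<And>Z. Z \<in> sets M \<Longrightarrow> Z \<subseteq> X 0 \<Longrightarrow> C ^ h * measure M Z \<le> measure M (Img_iter A E h Z)"
    and Z: "Z \<in> sets M" "Z \<subseteq> X 0"
  shows "C ^ j * measure M Z \<le> measure M (Img_iter A E j Z)"
proof -
  define R where "R = (\<Union>k<j. Img_iter A E k Z)"
  define B where "B = X 0 \<union> (\<Union>k\<le>j. Img_iter A E k Z)"
  have lay: "Img_iter A E k Z \<subseteq> X k" if "k \<le> j" for k
    using Img_iter_layer[OF Z(2), of k] that j by auto
  have X0: "X 0 \<in> sets M" using layer_sets by auto
  have disj: "Img_iter A E j Z \<inter> X k = {}" if "k < j" for k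
    using lay[of j] layer_unique[of _ j k] that j by auto
  have "is_cut R B"
    unfolding is_cut_def
  proof (intro conjI)
    show "R \<in> sets M" "B \<in> sets M" using Img_iter_sets[OF Z(1)] X0 by (auto simp: R_def B_def)
    show "R \<subseteq> B" "X 0 \<subseteq> B" by (auto simp: R_def B_def)
    show "Img_plus A E R \<subseteq> B"
    proof
      fix y assume "y \<in> Img_plus A E R"
      then obtain k where "k < j" "y \<in> Img_iter A E (Suc k) Z"
        by (auto simp: R_def mem_Img_plus Img_iter_Suc)
      then show "y \<in> B" unfolding B_def by (intro UnI2 UN_I[of "Suc k"]) auto
    qed
    show "R \<inter> X h = {}"
    proof -
      have "Img_iter A E k Z \<inter> X h = {}" if "k < j" for k
        using lay[of k] layer_unique[of _ k h] that j by fastforce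
      then show ?thesis by (auto simp: R_def)
    qed
  qed
  from weight_cut_ge[OF comm C h expand this]
  have "measure M (X 0) \<le> weight C (B - R)" by simp
  also have "B - R = (X 0 - Z) \<union> Img_iter A E j Z"
  proof -
    have "X 0 - R = X 0 - Z"
    proof -
      have "X 0 \<inter> Img_iter A E k Z \<subseteq> Z" if "k < j" for k
        using lay[of k] layer_unique[of _ k 0] that j by (cases "k = 0") (auto simp: Img_iter_def)
      moreover have "Z \<subseteq> R" using j by (auto simp: R_def Img_iter_def intro!: bexI[of _ 0])
      ultimately show ?thesis by (auto simp: R_def)
    qed
    moreover have "Img_iter A E j Z - R = Img_iter A E j Z"
    proof -
      have "Img_iter A E j Z \<inter> Img_iter A E k Z = {}" if "k < j" for k
        using disj[OF that] lay[of k] that by auto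
      then show ?thesis by (auto simp: R_def)
    qed
    moreover have "B = X 0 \<union> (R \<union> Img_iter A E j Z)"
      by (auto simp: B_def R_def le_less)
    ultimately show ?thesis by auto
  qed
  also have "weight C \<dots> = measure M (X 0 - Z) + measure M (Img_iter A E j Z) / C ^ j"
  proof (subst weight_Un)
    show "X 0 - Z \<in> sets M" "Img_iter A E j Z \<in> sets M" using Img_iter_sets X0 Z by auto
    show "(X 0 - Z) \<inter> Img_iter A E j Z = {}" using disj[of 0] j by auto
    show "weight C (X 0 - Z) + weight C (Img_iter A E j Z) =
        measure M (X 0 - Z) + measure M (Img_iter A E j Z) / C ^ j"
      using weight_layer[of "X 0 - Z" 0 C] weight_layer[OF lay[of j], of C] j by auto
  qed
  finally have "measure M Z \<le> measure M (Img_iter A E j Z) / C ^ j"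
    using finite_measure_Diff[OF X0 Z] by simp
  then show ?thesis using C by (simp add: field_simps)
qed

end

section \<open>Magnification ratios\<close>

text \<open>Null sets \<open>Z\<close>, which the infimum omits, satisfy the inequality on the right trivially.\<close>
lemma (in finite_measure) le_magnification_ratio_iff:
  assumes "c \<ge> 0"
  shows "ennreal c \<le> magnification_ratio M A E V0 k \<longleftrightarrow>
    (\<forall>Z\<in>sets M. Z \<subseteq> V0 \<longrightarrow> c * measure M Z \<le> measure M (Img_iter A E k Z))"
proof -
  have "ennreal c \<le> emeasure M I / emeasure M Z \<longleftrightarrow> c * measure M Z \<le> measure M I"
    if "emeasure M Z > 0" for Z I
    using that assms
    by (simp add: emeasure_eq_measure divide_ennreal ennreal_le_iff pos_le_divide_eq)
  moreover have "c * measure M Z \<le> measure M I" if "\<not> emeasure M Z > 0" for Z I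
    using that by (simp add: emeasure_eq_measure zero_less_measure_iff)
  ultimately show ?thesis
    unfolding magnification_ratio_def le_INF_iff by blast
qed

theorem theorem3p5:
  fixes M :: "'v measure" and A :: "'a set" and E :: "('v, 'a) edge set"
    and h j :: nat and X :: "nat \<Rightarrow> 'v set"
  assumes "h \<ge> 1"
    and "layered_measure_graph M A E h X"
    and "commutative_graph E"
    and "j \<in> {1..h}"
  shows "magnification_ratio M A E (X 0) j ^ h \<ge> magnification_ratio M A E (X 0) h ^ j"
proof -
  interpret layered_measure_graph M A E h X by fact
  let ?D = "magnification_ratio M A E (X 0)"
  consider "?D h = 0" | "?D h = top" | d where "d > 0" "?D h = ennreal d"
    by (cases "?D h") (auto simp: less_le)
  then show ?thesis
  proof cases
    case 1
    then show ?thesis using assms(4) by (simp add: power_0_left)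
  next
    case 2
    (* The ratio of a single admissible set is finite, so there is none. *)
    have "\<not> (Y \<in> sets M \<and> Y \<subseteq> X 0 \<and> emeasure M Y > 0)" for Y
    proof
      assume Y: "Y \<in> sets M \<and> Y \<subseteq> X 0 \<and> emeasure M Y > 0"
      then have "?D h \<le> emeasure M (Img_iter A E h Y) / emeasure M Y"
        unfolding magnification_ratio_def by (intro INF_lower) auto
      also have "\<dots> < top"
        using Y by (simp add: emeasure_eq_measure divide_ennreal)
      finally show False using 2 by simp
    qed
    then have "?D j = top" by (auto simp: magnification_ratio_def)
    then show ?thesis using assms by (simp add: power_eq_top_ennreal top_unique)
  next
    case 3
    define C where "C = root h d"
    have C: "C > 0" "C ^ h = d" using 3 assms by (auto simp: C_def real_root_gt_zero)
    have "ennreal (C ^ h) \<le> ?D h" using 3 C by simp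
    then have "C ^ h * measure M Z \<le> measure M (Img_iter A E h Z)" if "Z \<in> sets M" "Z \<subseteq> X 0" for Z
      using that C by (subst (asm) le_magnification_ratio_iff) auto
    then have "ennreal (C ^ j) \<le> ?D j"
      using measure_Img_iter_ge[OF assms(3) C(1) assms(1,4)] C
      by (subst le_magnification_ratio_iff) auto
    then have "ennreal (C ^ j) ^ h \<le> ?D j ^ h" by (rule power_mono) simp
    moreover have "ennreal (C ^ j) ^ h = ennreal ((C ^ h) ^ j)"
      using C(1) by (simp add: ennreal_power mult.commute flip: power_mult)
    moreover have "\<dots> = ?D h ^ j" using 3 C by (simp add: ennreal_power)
    ultimately show ?thesis by simp
  qed
qed

end
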